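(* Let $d\ge1$, $r<N$, $L^1,\ldots,L^d,G^1,\ldots,G^r\in C^1([a,b]\times\mathbb{R}^{2N};\mathbb{R})$ with $G^1,\ldots,G^r$ independent, $\mathbf{y}^a,\mathbf{y}^b\in\mathbb{R}^N$, and let $\mathcal{E}$ be the set of all $\mathbf{y}\in\mathbf{D}$ with $\mathbf{y}(a)=\mathbf{y}^a$, $\mathbf{y}(b)=\mathbf{y}^b$ and $G^j[\mathbf{y}]^{\alpha,\beta}_{\gamma}(x)\le0$ for $x\in[a,b]$, $j=1,\ldots,r$. A function $\bar{\mathbf{y}}\in\mathcal{E}$ is a Pareto optimal solution of the multiobjective problem $$\left(\int_a^bL^1[\mathbf{y}]^{\alpha,\beta}_{\gamma}(x)\,dx,\ldots,\int_a^bL^d[\mathbf{y}]^{\alpha,\beta}_{\gamma}(x)\,dx\right)\longrightarrow\min\quad\text{subject to }\mathbf{y}\in\mathcal{E}$$ if and only if, for each $i=1,\ldots,d$, $\bar{\mathbf{y}}$ is a solution to the scalar fractional variational problem $$\int_a^bL^i[\mathbf{y}]^{\alpha,\beta}_{\gamma}(x)\,dx\longrightarrow\min$$ subject to $\mathbf{y}\in\mathcal{E}$ and $$\int_a^bL^j[\mathbf{y}]^{\alpha,\beta}_{\gamma}(x)\,dx\le\int_a^bL^j[\bar{\mathbf{y}}]^{\alpha,\beta}_{\gamma}(x)\,dx,\qquad j=1,\ldots,d,\ j\ne i.$$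
   Context: Let $a<b$, $N,r\in\mathbb{N}$, and $\alpha,\beta,\gamma\in\mathbb{R}^N$ with $\alpha_i,\beta_i\in(0,1)$, $\gamma_i\in[0,1]$. For scalar $\alpha\in(0,1)$, the left and right Riemann--Liouville fractional integrals are ${}_aI_x^{\alpha}f(x)=\frac{1}{\Gamma(\alpha)}\int_a^x(x-t)^{\alpha-1}f(t)\,dt$ and ${}_xI_b^{\alpha}f(x)=\frac{1}{\Gamma(\alpha)}\int_x^b(t-x)^{\alpha-1}f(t)\,dt$. For $f\in AC([a,b])$ (absolutely continuous), the left and right Caputo derivatives are ${}^C_aD_x^{\alpha}f={}_aI_x^{1-\alpha}f'$ and ${}^C_xD_b^{\alpha}f=-\,{}_xI_b^{1-\alpha}f'$. For scalars $\alpha,\beta\in(0,1)$, $\gamma\in[0,1]$, ${}^CD^{\alpha,\beta}_{\gamma}=\gamma\,{}^C_aD_x^{\alpha}+(1-\gamma)\,{}^C_xD_b^{\beta}$. For vector parameters and $\mathbf{y}=(y_1,\ldots,y_N)$, ${}^CD^{\alpha,\beta}_{\gamma}\mathbf{y}=[{}^CD^{\alpha_1,\beta_1}_{\gamma_1}y_1,\ldots,{}^CD^{\alpha_N,\beta_N}_{\gamma_N}y_N]$. $\mathbf{D}$ is the set of $\mathbf{y}:[a,b]\to\mathbb{R}^N$ with components in $AC([a,b])$ such that ${}^CD^{\alpha,\beta}_{\gamma}\mathbf{y}$ exists and is continuous on $[a,b]$. $K[\mathbf{y}]^{\alpha,\beta}_{\gamma}(x)$ denotes $K$ evaluated at $(x,\mathbf{y}(x),{}^CD^{\alpha,\beta}_{\gamma}\mathbf{y}(x))$.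 Independence of $G^1,\ldots,G^r$: writing their arguments as $(p_1,\ldots,p_{2N+1})$, there is a nonvanishing Jacobian determinant of order $r$ of $(G^1,\ldots,G^r)$ with respect to some $r$ of the variables $p_{N+2},\ldots,p_{2N+1}$. With $\mathcal{J}^i(\mathbf{y})=\int_a^bL^i[\mathbf{y}]^{\alpha,\beta}_{\gamma}(x)\,dx$, $\bar{\mathbf{y}}\in\mathcal{E}$ is a Pareto optimal solution if there is no $\mathbf{y}\in\mathcal{E}$ with $\mathcal{J}^i(\mathbf{y})\le\mathcal{J}^i(\bar{\mathbf{y}})$ for all $i\in\{1,\ldots,d\}$ and $\mathcal{J}^i(\mathbf{y})<\mathcal{J}^i(\bar{\mathbf{y}})$ for some $i\in\{1,\ldots,d\}$. *)

theory Defs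
  imports "HOL-Analysis.Analysis" "Jordan_Normal_Form.Determinant"
begin

(* "$" below is the component of a vector in real ^ 'n. *)
no_notation Matrix.vec_index (infixl "$" 100)

definition AC_on :: "real set \<Rightarrow> (real \<Rightarrow> real) \<Rightarrow> bool" where
  "AC_on S f \<longleftrightarrow>
     (\<forall>\<epsilon>>0. \<exists>\<delta>>0. \<forall>I :: (real \<times> real) set.
        finite I \<longrightarrow> (\<forall>(u, v)\<in>I. u < v \<and> {u..v} \<subseteq> S) \<longrightarrow>
        pairwise (\<lambda>(u, v) (u', v'). {u<..<v} \<inter> {u'<..<v'} = {}) I \<longrightarrow>
        (\<Sum>(u, v)\<in>I. v - u) < \<delta> \<longrightarrow> (\<Sum>(u, v)\<in>I. \<bar>f v - f u\<bar>) < \<epsilon>)"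

(* The derivative at a boundary point of S is one-sided, hence "at z within S". *)
definition C1_on :: "'a::real_normed_vector set \<Rightarrow> ('a \<Rightarrow> real) \<Rightarrow> bool" where
  "C1_on S f \<longleftrightarrow>
     (\<exists>f' :: 'a \<Rightarrow> 'a \<Rightarrow>\<^sub>L real. continuous_on S f' \<and>
        (\<forall>z\<in>S. (f has_derivative blinfun_apply (f' z)) (at z within S)))"

definition left_RL_integral :: "real \<Rightarrow> real \<Rightarrow> (real \<Rightarrow> real) \<Rightarrow> real \<Rightarrow> real" where
  "left_RL_integral a \<alpha> f x =
     1 / Gamma \<alpha> * (LINT t:{a..x}|lebesgue. (x - t) powr (\<alpha> - 1) * f t)"

definition right_RL_integral :: "real \<Rightarrow> real \<Rightarrow> (real \<Rightarrow> real) \<Rightarrow> real \<Rightarrow> real" where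
  "right_RL_integral b \<alpha> f x =
     1 / Gamma \<alpha> * (LINT t:{x..b}|lebesgue. (t - x) powr (\<alpha> - 1) * f t)"

(* The Bochner integral is 0 for a non-integrable integrand, so existence at x is a
   separate predicate. *)
definition left_RL_exists :: "real \<Rightarrow> real \<Rightarrow> (real \<Rightarrow> real) \<Rightarrow> real \<Rightarrow> bool" where
  "left_RL_exists a \<alpha> f x \<longleftrightarrow>
     set_integrable lebesgue {a..x} (\<lambda>t. (x - t) powr (\<alpha> - 1) * f t)"

definition right_RL_exists :: "real \<Rightarrow> real \<Rightarrow> (real \<Rightarrow> real) \<Rightarrow> real \<Rightarrow> bool" where
  "right_RL_exists b \<alpha> f x \<longleftrightarrow>
     set_integrable lebesgue {x..b} (\<lambda>t. (t - x) powr (\<alpha> - 1) * f t)"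

(* An absolutely continuous f has a derivative almost everywhere; the value of deriv f on the
   remaining null set does not affect the integrals. *)
definition left_Caputo :: "real \<Rightarrow> real \<Rightarrow> (real \<Rightarrow> real) \<Rightarrow> real \<Rightarrow> real" where
  "left_Caputo a \<alpha> f x = left_RL_integral a (1 - \<alpha>) (deriv f) x"

definition right_Caputo :: "real \<Rightarrow> real \<Rightarrow> (real \<Rightarrow> real) \<Rightarrow> real \<Rightarrow> real" where
  "right_Caputo b \<alpha> f x = - right_RL_integral b (1 - \<alpha>) (deriv f) x"

definition combined_Caputo ::
    "real \<Rightarrow> real \<Rightarrow> real \<Rightarrow> real \<Rightarrow> real \<Rightarrow> (real \<Rightarrow> real) \<Rightarrow> real \<Rightarrow> real" where
  "combined_Caputo a b \<alpha> \<beta> \<gamma> f x =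
     \<gamma> * left_Caputo a \<alpha> f x + (1 - \<gamma>) * right_Caputo b \<beta> f x"

(* For \<gamma> = 1 (\<gamma> = 0) the operator is the left (right) Caputo derivative alone,
   and the existence of the other one is not required. *)
definition combined_Caputo_exists ::
    "real \<Rightarrow> real \<Rightarrow> real \<Rightarrow> real \<Rightarrow> real \<Rightarrow> (real \<Rightarrow> real) \<Rightarrow> real \<Rightarrow> bool" where
  "combined_Caputo_exists a b \<alpha> \<beta> \<gamma> f x \<longleftrightarrow>
     (\<gamma> \<noteq> 0 \<longrightarrow> left_RL_exists a (1 - \<alpha>) (deriv f) x) \<and>
     (\<gamma> \<noteq> 1 \<longrightarrow> right_RL_exists b (1 - \<beta>) (deriv f) x)"

definition combined_Caputo_vec ::
    "real \<Rightarrow> real \<Rightarrow> real ^ 'n \<Rightarrow> real ^ 'n \<Rightarrow> real ^ 'n \<Rightarrow> (real \<Rightarrow> real ^ 'n) \<Rightarrow> real \<Rightarrow> real ^ 'n"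
where
  "combined_Caputo_vec a b \<alpha> \<beta> \<gamma> y x =
     (\<chi> i. combined_Caputo a b (\<alpha> $ i) (\<beta> $ i) (\<gamma> $ i) (\<lambda>t. y t $ i) x)"

(* A map [a,b] \<rightarrow> R^N is represented by a total function; only its values on {a..b} matter. *)
definition admissible ::
    "real \<Rightarrow> real \<Rightarrow> real ^ 'n \<Rightarrow> real ^ 'n \<Rightarrow> real ^ 'n \<Rightarrow> (real \<Rightarrow> real ^ 'n) set" where
  "admissible a b \<alpha> \<beta> \<gamma> =
     {y. (\<forall>i. AC_on {a..b} (\<lambda>t. y t $ i)) \<and>
         (\<forall>i. \<forall>x\<in>{a..b}.
            combined_Caputo_exists a b (\<alpha> $ i) (\<beta> $ i) (\<gamma> $ i) (\<lambda>t. y t $ i) x) \<and>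
         continuous_on {a..b} (combined_Caputo_vec a b \<alpha> \<beta> \<gamma> y)}"

definition along ::
    "(real \<times> (real ^ 'n) \<times> (real ^ 'n) \<Rightarrow> real) \<Rightarrow> real \<Rightarrow> real \<Rightarrow>
     real ^ 'n \<Rightarrow> real ^ 'n \<Rightarrow> real ^ 'n \<Rightarrow> (real \<Rightarrow> real ^ 'n) \<Rightarrow> real \<Rightarrow> real" where
  "along K a b \<alpha> \<beta> \<gamma> y x = K (x, y x, combined_Caputo_vec a b \<alpha> \<beta> \<gamma> y x)"

(* The partial derivative of G with respect to component k of its last vector argument,
   that is, with respect to one of the variables p_(N+2), ..., p_(2N+1). *)
definition partial_last ::
    "(real \<times> (real ^ 'n) \<times> (real ^ 'n) \<Rightarrow> real) \<Rightarrow> 'n \<Rightarrow> real \<times> (real ^ 'n) \<times> (real ^ 'n) \<Rightarrow> real" where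
  "partial_last G k = (\<lambda>(x, u, v). deriv (\<lambda>s. G (x, u, v + s *\<^sub>R axis k 1)) 0)"

(* \<sigma> selects the r variables; the Jacobian determinant with respect to them vanishes at no
   point of [a,b] x R^(2N).  Matrix indices start at 0, whence Suc. *)
definition independent_constraints ::
    "real \<Rightarrow> real \<Rightarrow> nat \<Rightarrow> (nat \<Rightarrow> real \<times> (real ^ 'n) \<times> (real ^ 'n) \<Rightarrow> real) \<Rightarrow> bool" where
  "independent_constraints a b r G \<longleftrightarrow>
     (\<exists>\<sigma> :: nat \<Rightarrow> 'n. inj_on \<sigma> {..<r} \<and>
        (\<forall>p \<in> {a..b} \<times> UNIV.
           Determinant.det (Matrix.mat r r (\<lambda>(i, j). partial_last (G (Suc i)) (\<sigma> j) p)) \<noteq> 0))"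

definition feasible ::
    "real \<Rightarrow> real \<Rightarrow> real ^ 'n \<Rightarrow> real ^ 'n \<Rightarrow> real ^ 'n \<Rightarrow> nat \<Rightarrow>
     (nat \<Rightarrow> real \<times> (real ^ 'n) \<times> (real ^ 'n) \<Rightarrow> real) \<Rightarrow> real ^ 'n \<Rightarrow> real ^ 'n \<Rightarrow>
     (real \<Rightarrow> real ^ 'n) set" where
  "feasible a b \<alpha> \<beta> \<gamma> r G ya yb =
     {y \<in> admissible a b \<alpha> \<beta> \<gamma>. y a = ya \<and> y b = yb \<and>
        (\<forall>j\<in>{1..r}. \<forall>x\<in>{a..b}. along (G j) a b \<alpha> \<beta> \<gamma> y x \<le> 0)}"

definition action ::
    "(real \<times> (real ^ 'n) \<times> (real ^ 'n) \<Rightarrow> real) \<Rightarrow> real \<Rightarrow> real \<Rightarrow>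
     real ^ 'n \<Rightarrow> real ^ 'n \<Rightarrow> real ^ 'n \<Rightarrow> (real \<Rightarrow> real ^ 'n) \<Rightarrow> real" where
  "action L a b \<alpha> \<beta> \<gamma> y = (LINT x:{a..b}|lebesgue. along L a b \<alpha> \<beta> \<gamma> y x)"

definition Pareto_optimal :: "nat \<Rightarrow> (nat \<Rightarrow> 'a \<Rightarrow> real) \<Rightarrow> 'a set \<Rightarrow> 'a \<Rightarrow> bool" where
  "Pareto_optimal d J E ybar \<longleftrightarrow>
     ybar \<in> E \<and>
     \<not> (\<exists>y\<in>E. (\<forall>i\<in>{1..d}. J i y \<le> J i ybar) \<and> (\<exists>i\<in>{1..d}. J i y < J i ybar))"

end

theory Submission
  imports Defs
begin

text \<open>Both sides exclude the same competitor: a \<open>y\<close> in \<open>E\<close> with some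
  \<open>J i\<close> strictly below its value at \<open>ybar\<close> and no other \<open>J j\<close>
  above. Pareto optimality excludes it for all \<open>i\<close> at once; the scalar problems fix
  \<open>i\<close> first and turn the other inequalities into constraints. The argument is purely
  order-theoretic, so it is stated for abstract \<open>J\<close> and \<open>E\<close>.\<close>

lemma Pareto_optimal_iff_is_arg_min:
  fixes J :: "nat \<Rightarrow> 'a \<Rightarrow> real"
  assumes "ybar \<in> E"
  shows "Pareto_optimal d J E ybar \<longleftrightarrow>
    (\<forall>i\<in>{1..d}. is_arg_min (J i)
       (\<lambda>y. y \<in> E \<and> (\<forall>j\<in>{1..d} - {i}. J j y \<le> J j ybar)) ybar)"
    (is "_ \<longleftrightarrow> ?scalar")
proof
  assume pareto: "Pareto_optimal d J E ybar"
  have False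
    if i: "i \<in> {1..d}" and y: "y \<in> E" and le: "\<forall>j\<in>{1..d} - {i}. J j y \<le> J j ybar"
      and less: "J i y < J i ybar" for i y
  proof -
    \<comment> \<open>The constraints of problem \<open>i\<close> skip the index \<open>i\<close>;
      the strict decrease of \<open>J i\<close> fills the gap.\<close>
    have "\<forall>j\<in>{1..d}. J j y \<le> J j ybar"
      using le less by (metis DiffI less_imp_le singletonD)
    then show False
      using pareto i y less unfolding Pareto_optimal_def by blast
  qed
  \<comment> \<open>\<open>is_arg_min\<close> also demands that \<open>ybar\<close> be feasible for
    problem \<open>i\<close>: its constraints hold there with equality.\<close>
  then show ?scalar
    using assms unfolding is_arg_min_def by blast
next
  assume ?scalar
  \<comment> \<open>A \<open>y\<close> dominating \<open>ybar\<close>, strictly at \<open>i\<close>,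
    is feasible for problem \<open>i\<close> and beats \<open>ybar\<close> there.\<close>
  then show "Pareto_optimal d J E ybar"
    using assms unfolding Pareto_optimal_def is_arg_min_def by blast
qed

theorem theorem5p4:
  fixes a b :: real
    and \<alpha> \<beta> \<gamma> ya yb :: "real ^ 'n"
    and d r :: nat
    and L G :: "nat \<Rightarrow> real \<times> (real ^ 'n) \<times> (real ^ 'n) \<Rightarrow> real"
    and ybar :: "real \<Rightarrow> real ^ 'n"
  defines "E \<equiv> feasible a b \<alpha> \<beta> \<gamma> r G ya yb"
    and "J \<equiv> \<lambda>i. action (L i) a b \<alpha> \<beta> \<gamma>"
  assumes "a < b"
    and "\<forall>k. 0 < \<alpha> $ k \<and> \<alpha> $ k < 1"
    and "\<forall>k. 0 < \<beta> $ k \<and> \<beta> $ k < 1"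
    and "\<forall>k. 0 \<le> \<gamma> $ k \<and> \<gamma> $ k \<le> 1"
    and "1 \<le> d" and "r < CARD('n)"
    and "\<forall>i\<in>{1..d}. C1_on ({a..b} \<times> UNIV) (L i)"
    and "\<forall>j\<in>{1..r}. C1_on ({a..b} \<times> UNIV) (G j)"
    and "independent_constraints a b r G"
    and "ybar \<in> E"
  shows "Pareto_optimal d J E ybar \<longleftrightarrow>
    (\<forall>i\<in>{1..d}. is_arg_min (J i)
       (\<lambda>y. y \<in> E \<and> (\<forall>j\<in>{1..d} - {i}. J j y \<le> J j ybar)) ybar)"
  using assms by (intro Pareto_optimal_iff_is_arg_min)

end
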